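(* Let $K$ be a field, $\lambda\in K$. Let $(A,\mu,1,\alpha_A,\beta_A,\psi_A,\omega_A,r)$ be a quasitriangular unitary $\lambda$-infBH-bialgebra and let $(M,\triangleleft,\alpha_M,\beta_M)$ be a right $(A,\mu,\alpha_A,\beta_A)$-module, with $\alpha_M$ invertible. Let $\psi_M,\omega_M:M\to M$ be linear maps such that $\alpha_M\omega_M=\omega_M\alpha_M$ and $\omega_M(m\triangleleft a)=\omega_M(m)\triangleleft\omega_A(a)$ for $a\in A$, $m\in M$. Then $(M,\triangleleft,\varphi,\alpha_M,\beta_M,\psi_M,\omega_M)$ is a right $\lambda$-infBH-Hopf module over $A$ (with comultiplication $\Delta_r$), where the coaction $\varphi:M\to M\otimes A$ is given by $$\varphi(m)=\omega_M\alpha_M^{-1}(m)\triangleleft r^1\otimes\beta_A(r^2)-\lambda\,\omega_M(m)\otimes1,\qquad m\in M.$$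
   Context: Everything is over the field $K$. BiHom-associative algebra $(A,\mu,\alpha,\beta)$: $\mu$ (written $ab$) and $\alpha,\beta$ linear, $\alpha\beta=\beta\alpha$, $\alpha,\beta$ multiplicative, $\alpha(a)(bc)=(ab)\beta(c)$. Unitary: there is $1\in A$ with $\alpha(1)=\beta(1)=1$, $a1=\alpha(a)$, $1a=\beta(a)$. Quasitriangular unitary $\lambda$-infBH-bialgebra ($\lambda$-infinitesimal BiHom-bialgebra) $(A,\mu,1,\alpha,\beta,\psi,\omega,r)$: $(A,\mu,1,\alpha,\beta)$ is a unitary BiHom-associative algebra with $\alpha,\beta$ bijective; $\psi,\omega:A\to A$ are linear, multiplicative, each commutes with $\alpha$ and with $\beta$, and $\psi(1)=\omega(1)=1$; $r=r^1\otimes r^2\in A\otimes A$ (summation understood) is invariant under $f\otimes f$ for $f\in\{\alpha,\beta,\psi,\omega\}$; and, with $\bar r$ a second copy of $r$, $$\omega(r^1)\bar r^1\otimes\beta(\bar r^2)\otimes\alpha\psi(r^2)-\alpha(r^1)\otimes r^2\bar r^1\otimes\beta(\bar r^2)+\beta\omega(r^1)\otimes\alpha(\bar r^1)\otimes\bar r^2\psi(r^2)=\lambda\,\omega(r^1)\otimes1\otimes\psi(r^2).$$ Its comultiplication is $\Delta_r(a)=\omega\alpha^{-1}(a)r^1\otimes\beta(r^2)-\alpha(r^1)\otimes r^2\psi\beta^{-1}(a)-\lambda\,\omega(a)\otimes1$. Right module $(M,\triangleleft,\alpha_M,\beta_M)$: $\alpha_M\beta_M=\beta_M\alpha_M$;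 $f_M(m\triangleleft a)=f_M(m)\triangleleft f_A(a)$ for $f\in\{\alpha,\beta\}$; $\alpha_M(m)\triangleleft(aa')=(m\triangleleft a)\triangleleft\beta_A(a')$. Right comodule $(M,\varphi,\psi_M,\omega_M)$ over $(A,\Delta,\psi_A,\omega_A)$: $\psi_M\omega_M=\omega_M\psi_M$; $(g_M\otimes g_A)\varphi=\varphi g_M$ for $g\in\{\psi,\omega\}$; $(\omega_M\otimes\Delta)\varphi=(\varphi\otimes\psi_A)\varphi$. Right $\lambda$-infBH-Hopf module $(M,\triangleleft,\varphi,\alpha_M,\beta_M,\psi_M,\omega_M)$: a right module and a right comodule, any two of $\alpha_M,\beta_M,\psi_M,\omega_M$ commute, and, with $\varphi(m)=m_{(0)}\otimes m_{(1)}$, $\Delta(a)=a_1\otimes a_2$, $\varphi(m\triangleleft a)=\omega_M(m)\triangleleft a_1\otimes\beta_A(a_2)+\alpha_M(m_{(0)})\otimes m_{(1)}\psi_A(a)+\lambda\,\alpha_M\omega_M(m)\otimes\beta_A\psi_A(a)$.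
   Formalization: As printed the claim fails, since nothing ties $\psi_M$ to the other data; additionally assumed: $\psi_M$ commutes with $\alpha_M,\beta_M,\omega_M$; $\beta_M\omega_M=\omega_M\beta_M$; and $\psi_M(m\triangleleft a)=\psi_M(m)\triangleleft\psi_A(a)$. *)

theory Defs
  imports Complex_Main "HOL-Library.Poly_Mapping"
begin

section \<open>Tensor products of vector spaces\<close>

text \<open>
  A vector space over the field \<open>'k\<close> is a type \<open>'a :: ab_group_add\<close> with a scalar multiplication
  \<open>s\<close> satisfying \<open>vector_space s\<close>.  The tensor product is the free vector space on pairs
  (finitely supported functions) modulo the subspace generated by the bilinearity relations;
  a tensor is a coset of that subspace.  The scalar multiplications are terms, so this
  quotient cannot be a type of its own: its elements are sets, and its operations take the subspace
  of relations as an argument.  The threefold tensor product is built without brackets,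
  from triples modulo trilinearity.
\<close>

definition fscale :: "'k::field \<Rightarrow> ('x \<Rightarrow>\<^sub>0 'k) \<Rightarrow> ('x \<Rightarrow>\<^sub>0 'k)" where
  "fscale c p = Poly_Mapping.map (\<lambda>d. c * d) p"

lemma lookup_fscale [simp]:
  "Poly_Mapping.lookup (fscale c p) x = c * Poly_Mapping.lookup p x"
  by (simp add: fscale_def Poly_Mapping.map.rep_eq when_def)

lemma vector_space_fscale: "vector_space fscale"
  by unfold_locales (auto intro!: poly_mapping_eqI simp: lookup_add algebra_simps)

abbreviation gen :: "'x \<Rightarrow> ('x \<Rightarrow>\<^sub>0 'k::field)" where
  "gen x \<equiv> Poly_Mapping.single x 1"

definition linear_ext :: "('x \<Rightarrow> ('y \<Rightarrow>\<^sub>0 'k::field)) \<Rightarrow> ('x \<Rightarrow>\<^sub>0 'k) \<Rightarrow> ('y \<Rightarrow>\<^sub>0 'k)" where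
  "linear_ext h p = (\<Sum>x\<in>Poly_Mapping.keys p. fscale (Poly_Mapping.lookup p x) (h x))"

definition tensor2 ::
  "('k::field \<Rightarrow> 'a::ab_group_add \<Rightarrow> 'a) \<Rightarrow> ('k \<Rightarrow> 'b::ab_group_add \<Rightarrow> 'b)
     \<Rightarrow> ('a \<times> 'b \<Rightarrow>\<^sub>0 'k) set" where
  "tensor2 s t = module.span fscale
     ({gen (a + a', b) - gen (a, b) - gen (a', b) | a a' b. True} \<union>
      {gen (s c a, b) - fscale c (gen (a, b)) | c a b. True} \<union>
      {gen (a, b + b') - gen (a, b) - gen (a, b') | a b b'. True} \<union>
      {gen (a, t c b) - fscale c (gen (a, b)) | c a b. True})"

definition tensor3 ::
  "('k::field \<Rightarrow> 'a::ab_group_add \<Rightarrow> 'a) \<Rightarrow> ('k \<Rightarrow> 'b::ab_group_add \<Rightarrow> 'b)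
     \<Rightarrow> ('k \<Rightarrow> 'c::ab_group_add \<Rightarrow> 'c) \<Rightarrow> ('a \<times> 'b \<times> 'c \<Rightarrow>\<^sub>0 'k) set" where
  "tensor3 s t u = module.span fscale
     ({gen (a + a', b, d) - gen (a, b, d) - gen (a', b, d) | a a' b d. True} \<union>
      {gen (s c a, b, d) - fscale c (gen (a, b, d)) | c a b d. True} \<union>
      {gen (a, b + b', d) - gen (a, b, d) - gen (a, b', d) | a b b' d. True} \<union>
      {gen (a, t c b, d) - fscale c (gen (a, b, d)) | c a b d. True} \<union>
      {gen (a, b, d + d') - gen (a, b, d) - gen (a, b, d') | a b d d'. True} \<union>
      {gen (a, b, u c d) - fscale c (gen (a, b, d)) | c a b d. True})"

text \<open>Below \<open>N\<close> is one of these subspaces of relations and \<open>X\<close>, \<open>Y\<close> are cosets of it.\<close>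

definition coset :: "('x \<Rightarrow>\<^sub>0 'k::field) set \<Rightarrow> ('x \<Rightarrow>\<^sub>0 'k) \<Rightarrow> ('x \<Rightarrow>\<^sub>0 'k) set" where
  "coset N x = {y. y - x \<in> N}"

definition tensors :: "('x \<Rightarrow>\<^sub>0 'k::field) set \<Rightarrow> ('x \<Rightarrow>\<^sub>0 'k) set set" where
  "tensors N = range (coset N)"

definition rep :: "('x \<Rightarrow>\<^sub>0 'k::field) set \<Rightarrow> ('x \<Rightarrow>\<^sub>0 'k)" where
  "rep X = (SOME x. x \<in> X)"

definition tadd :: "('x \<Rightarrow>\<^sub>0 'k::field) set \<Rightarrow> ('x \<Rightarrow>\<^sub>0 'k) set \<Rightarrow> ('x \<Rightarrow>\<^sub>0 'k) set \<Rightarrow> ('x \<Rightarrow>\<^sub>0 'k) set"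
  ("(_ \<oplus>\<index> _)" [65, 66] 65)
  where "X \<oplus>\<^bsub>N\<^esub> Y = coset N (rep X + rep Y)"

definition tdiff :: "('x \<Rightarrow>\<^sub>0 'k::field) set \<Rightarrow> ('x \<Rightarrow>\<^sub>0 'k) set \<Rightarrow> ('x \<Rightarrow>\<^sub>0 'k) set \<Rightarrow> ('x \<Rightarrow>\<^sub>0 'k) set"
  ("(_ \<ominus>\<index> _)" [65, 66] 65)
  where "X \<ominus>\<^bsub>N\<^esub> Y = coset N (rep X - rep Y)"

definition tscale :: "('x \<Rightarrow>\<^sub>0 'k::field) set \<Rightarrow> 'k \<Rightarrow> ('x \<Rightarrow>\<^sub>0 'k) set \<Rightarrow> ('x \<Rightarrow>\<^sub>0 'k) set"
  ("(_ \<odot>\<index> _)" [71, 70] 70)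
  where "c \<odot>\<^bsub>N\<^esub> X = coset N (fscale c (rep X))"

text \<open>\<open>pure N (a, b)\<close> is \<open>a \<otimes> b\<close>, and \<open>pure N (a, b, c)\<close> is \<open>a \<otimes> b \<otimes> c\<close>.\<close>

definition pure :: "('x \<Rightarrow>\<^sub>0 'k::field) set \<Rightarrow> 'x \<Rightarrow> ('x \<Rightarrow>\<^sub>0 'k) set" where
  "pure N x = coset N (gen x)"

text \<open>
  \<open>lift N h X\<close> is the value at the tensor \<open>X\<close> of the linear map into the quotient by \<open>N\<close> that is
  given on pure tensors by the multilinear map \<open>h\<close>.  So the Sweedler-type expression
  \<open>F(x\<^sup>1, x\<^sup>2)\<close> for \<open>X = x\<^sup>1 \<otimes> x\<^sup>2\<close>, summation understood, is \<open>lift N (\<lambda>(x1, x2). F x1 x2) X\<close>.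
\<close>

definition lift ::
  "('y \<Rightarrow>\<^sub>0 'k::field) set \<Rightarrow> ('x \<Rightarrow> ('y \<Rightarrow>\<^sub>0 'k) set) \<Rightarrow> ('x \<Rightarrow>\<^sub>0 'k) set \<Rightarrow> ('y \<Rightarrow>\<^sub>0 'k) set" where
  "lift N h X = coset N (linear_ext (\<lambda>x. rep (h x)) (rep X))"

text \<open>\<open>tmap N f g\<close> is \<open>f \<otimes> g\<close>, where \<open>N\<close> belongs to the target.\<close>

definition tmap ::
  "('c \<times> 'd \<Rightarrow>\<^sub>0 'k::field) set \<Rightarrow> ('a \<Rightarrow> 'c) \<Rightarrow> ('b \<Rightarrow> 'd) \<Rightarrow> ('a \<times> 'b \<Rightarrow>\<^sub>0 'k) set \<Rightarrow> ('c \<times> 'd \<Rightarrow>\<^sub>0 'k) set"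
  where "tmap N f g = lift N (\<lambda>(a, b). pure N (f a, g b))"

definition linear_to_tensors ::
  "('k::field \<Rightarrow> 'a::ab_group_add \<Rightarrow> 'a) \<Rightarrow> ('x \<Rightarrow>\<^sub>0 'k) set \<Rightarrow> ('a \<Rightarrow> ('x \<Rightarrow>\<^sub>0 'k) set) \<Rightarrow> bool" where
  "linear_to_tensors s N f \<longleftrightarrow>
     (\<forall>x. f x \<in> tensors N) \<and>
     (\<forall>x y. f (x + y) = f x \<oplus>\<^bsub>N\<^esub> f y) \<and>
     (\<forall>c x. f (s c x) = c \<odot>\<^bsub>N\<^esub> f x)"


section \<open>BiHom-associative algebras and quasitriangular \<open>\<lambda>\<close>-infBH-bialgebras\<close>

locale bihom_algebra = vector_space scale
  for scale :: "'k::field \<Rightarrow> 'a::ab_group_add \<Rightarrow> 'a" +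
  fixes mult :: "'a \<Rightarrow> 'a \<Rightarrow> 'a" and \<alpha> :: "'a \<Rightarrow> 'a" and \<beta> :: "'a \<Rightarrow> 'a"
  assumes linear_mult_left: "\<And>a. Vector_Spaces.linear scale scale (\<lambda>b. mult a b)"
    and linear_mult_right: "\<And>b. Vector_Spaces.linear scale scale (\<lambda>a. mult a b)"
    and linear_\<alpha>: "Vector_Spaces.linear scale scale \<alpha>"
    and linear_\<beta>: "Vector_Spaces.linear scale scale \<beta>"
    and \<alpha>_\<beta>_commute: "\<And>a. \<alpha> (\<beta> a) = \<beta> (\<alpha> a)"
    and \<alpha>_mult: "\<And>a b. \<alpha> (mult a b) = mult (\<alpha> a) (\<alpha> b)"
    and \<beta>_mult: "\<And>a b. \<beta> (mult a b) = mult (\<beta> a) (\<beta> b)"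
    and bihom_assoc: "\<And>a b c. mult (\<alpha> a) (mult b c) = mult (mult a b) (\<beta> c)"

locale unitary_bihom_algebra = bihom_algebra scale mult \<alpha> \<beta>
  for scale :: "'k::field \<Rightarrow> 'a::ab_group_add \<Rightarrow> 'a" and mult and one :: 'a and \<alpha> \<beta> +
  assumes \<alpha>_one: "\<alpha> one = one"
    and \<beta>_one: "\<beta> one = one"
    and mult_one: "\<And>a. mult a one = \<alpha> a"
    and one_mult: "\<And>a. mult one a = \<beta> a"

text \<open>In the Yang-Baxter type equation \<open>(r1, r2)\<close> and \<open>(s1, s2)\<close> run over the two copies of \<open>r\<close>.\<close>

locale quasitriangular_infBH_bialgebra = unitary_bihom_algebra scale mult one \<alpha> \<beta>
  for lam :: "'k::field" and scale :: "'k \<Rightarrow> 'a::ab_group_add \<Rightarrow> 'a" and mult and one :: 'a and \<alpha> \<beta> +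
  fixes \<psi> :: "'a \<Rightarrow> 'a" and \<omega> :: "'a \<Rightarrow> 'a" and r :: "('a \<times> 'a \<Rightarrow>\<^sub>0 'k) set"
  assumes bij_\<alpha>: "bij \<alpha>"
    and bij_\<beta>: "bij \<beta>"
    and linear_\<psi>: "Vector_Spaces.linear scale scale \<psi>"
    and linear_\<omega>: "Vector_Spaces.linear scale scale \<omega>"
    and \<psi>_mult: "\<And>a b. \<psi> (mult a b) = mult (\<psi> a) (\<psi> b)"
    and \<omega>_mult: "\<And>a b. \<omega> (mult a b) = mult (\<omega> a) (\<omega> b)"
    and \<psi>_\<alpha>_commute: "\<And>a. \<psi> (\<alpha> a) = \<alpha> (\<psi> a)"
    and \<psi>_\<beta>_commute: "\<And>a. \<psi> (\<beta> a) = \<beta> (\<psi> a)"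
    and \<omega>_\<alpha>_commute: "\<And>a. \<omega> (\<alpha> a) = \<alpha> (\<omega> a)"
    and \<omega>_\<beta>_commute: "\<And>a. \<omega> (\<beta> a) = \<beta> (\<omega> a)"
    and \<psi>_one: "\<psi> one = one"
    and \<omega>_one: "\<omega> one = one"
    and r_tensor: "r \<in> tensors (tensor2 scale scale)"
    and r_invariant: "\<And>f. f \<in> {\<alpha>, \<beta>, \<psi>, \<omega>} \<Longrightarrow> tmap (tensor2 scale scale) f f r = r"
    and r_yang_baxter:
      "let T = tensor3 scale scale scale in
         lift T (\<lambda>(r1, r2). lift T (\<lambda>(s1, s2). pure T (mult (\<omega> r1) s1, \<beta> s2, \<alpha> (\<psi> r2))) r) r
         \<ominus>\<^bsub>T\<^esub> lift T (\<lambda>(r1, r2). lift T (\<lambda>(s1, s2). pure T (\<alpha> r1, mult r2 s1, \<beta> s2)) r) r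
         \<oplus>\<^bsub>T\<^esub> lift T (\<lambda>(r1, r2). lift T (\<lambda>(s1, s2). pure T (\<beta> (\<omega> r1), \<alpha> s1, mult s2 (\<psi> r2))) r) r
       = lam \<odot>\<^bsub>T\<^esub> lift T (\<lambda>(r1, r2). pure T (\<omega> r1, one, \<psi> r2)) r"

definition comult_r ::
  "'k::field \<Rightarrow> ('k \<Rightarrow> 'a::ab_group_add \<Rightarrow> 'a) \<Rightarrow> ('a \<Rightarrow> 'a \<Rightarrow> 'a) \<Rightarrow> 'a \<Rightarrow> ('a \<Rightarrow> 'a) \<Rightarrow> ('a \<Rightarrow> 'a)
     \<Rightarrow> ('a \<Rightarrow> 'a) \<Rightarrow> ('a \<Rightarrow> 'a) \<Rightarrow> ('a \<times> 'a \<Rightarrow>\<^sub>0 'k) set \<Rightarrow> 'a \<Rightarrow> ('a \<times> 'a \<Rightarrow>\<^sub>0 'k) set" where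
  "comult_r lam scale mult one \<alpha> \<beta> \<psi> \<omega> r a =
     (let T = tensor2 scale scale in
        lift T (\<lambda>(r1, r2). pure T (mult (\<omega> (inv \<alpha> a)) r1, \<beta> r2)) r
        \<ominus>\<^bsub>T\<^esub> lift T (\<lambda>(r1, r2). pure T (\<alpha> r1, mult r2 (\<psi> (inv \<beta> a)))) r
        \<ominus>\<^bsub>T\<^esub> lam \<odot>\<^bsub>T\<^esub> pure T (\<omega> a, one))"


section \<open>Modules, comodules and Hopf modules\<close>

locale right_bihom_module =
  A: bihom_algebra scaleA mult \<alpha>A \<beta>A + M: vector_space scaleM
  for scaleA :: "'k::field \<Rightarrow> 'a::ab_group_add \<Rightarrow> 'a" and mult \<alpha>A \<beta>A
    and scaleM :: "'k \<Rightarrow> 'm::ab_group_add \<Rightarrow> 'm" +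
  fixes act :: "'m \<Rightarrow> 'a \<Rightarrow> 'm" and \<alpha>M :: "'m \<Rightarrow> 'm" and \<beta>M :: "'m \<Rightarrow> 'm"
  assumes linear_act_left: "\<And>m. Vector_Spaces.linear scaleA scaleM (\<lambda>a. act m a)"
    and linear_act_right: "\<And>a. Vector_Spaces.linear scaleM scaleM (\<lambda>m. act m a)"
    and linear_\<alpha>M: "Vector_Spaces.linear scaleM scaleM \<alpha>M"
    and linear_\<beta>M: "Vector_Spaces.linear scaleM scaleM \<beta>M"
    and \<alpha>M_\<beta>M_commute: "\<And>m. \<alpha>M (\<beta>M m) = \<beta>M (\<alpha>M m)"
    and \<alpha>M_act: "\<And>m a. \<alpha>M (act m a) = act (\<alpha>M m) (\<alpha>A a)"
    and \<beta>M_act: "\<And>m a. \<beta>M (act m a) = act (\<beta>M m) (\<beta>A a)"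
    and act_assoc: "\<And>m a a'. act (\<alpha>M m) (mult a a') = act (act m a) (\<beta>A a')"

text \<open>Linearity of \<open>\<Delta>\<close>, \<open>\<psi>A\<close> and \<open>\<omega>A\<close> is what makes \<open>\<omega>M \<otimes> \<Delta>\<close> and \<open>\<phi> \<otimes> \<psi>A\<close> meaningful.\<close>

locale right_bihom_comodule =
  A: vector_space scaleA + M: vector_space scaleM
  for scaleA :: "'k::field \<Rightarrow> 'a::ab_group_add \<Rightarrow> 'a"
    and scaleM :: "'k \<Rightarrow> 'm::ab_group_add \<Rightarrow> 'm" +
  fixes \<Delta> :: "'a \<Rightarrow> ('a \<times> 'a \<Rightarrow>\<^sub>0 'k) set" and \<psi>A :: "'a \<Rightarrow> 'a" and \<omega>A :: "'a \<Rightarrow> 'a"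
    and \<phi> :: "'m \<Rightarrow> ('m \<times> 'a \<Rightarrow>\<^sub>0 'k) set" and \<psi>M :: "'m \<Rightarrow> 'm" and \<omega>M :: "'m \<Rightarrow> 'm"
  assumes linear_\<Delta>: "linear_to_tensors scaleA (tensor2 scaleA scaleA) \<Delta>"
    and linear_\<psi>A: "Vector_Spaces.linear scaleA scaleA \<psi>A"
    and linear_\<omega>A: "Vector_Spaces.linear scaleA scaleA \<omega>A"
    and linear_\<phi>: "linear_to_tensors scaleM (tensor2 scaleM scaleA) \<phi>"
    and linear_\<psi>M: "Vector_Spaces.linear scaleM scaleM \<psi>M"
    and linear_\<omega>M: "Vector_Spaces.linear scaleM scaleM \<omega>M"
    and \<psi>M_\<omega>M_commute: "\<And>m. \<psi>M (\<omega>M m) = \<omega>M (\<psi>M m)"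
    and \<psi>_\<phi>: "\<And>m. tmap (tensor2 scaleM scaleA) \<psi>M \<psi>A (\<phi> m) = \<phi> (\<psi>M m)"
    and \<omega>_\<phi>: "\<And>m. tmap (tensor2 scaleM scaleA) \<omega>M \<omega>A (\<phi> m) = \<phi> (\<omega>M m)"
    and bihom_coassoc:
      "\<And>m. let T = tensor3 scaleM scaleA scaleA in
         lift T (\<lambda>(m0, m1). lift T (\<lambda>(a1, a2). pure T (\<omega>M m0, a1, a2)) (\<Delta> m1)) (\<phi> m)
       = lift T (\<lambda>(m0, m1). lift T (\<lambda>(n0, n1). pure T (n0, n1, \<psi>A m1)) (\<phi> m0)) (\<phi> m)"

locale right_infBH_hopf_module =
  right_bihom_module scaleA mult \<alpha>A \<beta>A scaleM act \<alpha>M \<beta>M +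
  right_bihom_comodule scaleA scaleM \<Delta> \<psi>A \<omega>A \<phi> \<psi>M \<omega>M
  for lam :: "'k::field"
    and scaleA :: "'k \<Rightarrow> 'a::ab_group_add \<Rightarrow> 'a" and mult \<alpha>A \<beta>A \<Delta> \<psi>A \<omega>A
    and scaleM :: "'k \<Rightarrow> 'm::ab_group_add \<Rightarrow> 'm" and act \<phi> \<alpha>M \<beta>M \<psi>M \<omega>M +
  assumes \<alpha>M_\<psi>M_commute: "\<And>m. \<alpha>M (\<psi>M m) = \<psi>M (\<alpha>M m)"
    and \<alpha>M_\<omega>M_commute: "\<And>m. \<alpha>M (\<omega>M m) = \<omega>M (\<alpha>M m)"
    and \<beta>M_\<psi>M_commute: "\<And>m. \<beta>M (\<psi>M m) = \<psi>M (\<beta>M m)"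
    and \<beta>M_\<omega>M_commute: "\<And>m. \<beta>M (\<omega>M m) = \<omega>M (\<beta>M m)"
    and hopf_compatibility:
      "\<And>m a. let T = tensor2 scaleM scaleA in
         \<phi> (act m a) =
           lift T (\<lambda>(a1, a2). pure T (act (\<omega>M m) a1, \<beta>A a2)) (\<Delta> a)
           \<oplus>\<^bsub>T\<^esub> lift T (\<lambda>(m0, m1). pure T (\<alpha>M m0, mult m1 (\<psi>A a))) (\<phi> m)
           \<oplus>\<^bsub>T\<^esub> lam \<odot>\<^bsub>T\<^esub> pure T (\<alpha>M (\<omega>M m), \<beta>A (\<psi>A a))"

end

theory Submission
  imports Defs
begin

text \<open>
  Two tensors are equal iff all multilinear maps agree on them, so every identity between tensors
  becomes an identity between finite sums over a representative of \<open>r\<close>.  Since \<open>\<Delta>\<^sub>r(1) = -\<lambda> 1 \<otimes> 1\<close>,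
  coassociativity of the coaction reduces to the image of the Yang-Baxter type equation under
  \<open>x \<otimes> y \<otimes> z \<mapsto> (p \<triangleleft> x) \<otimes> \<beta>(y) \<otimes> \<beta>(z)\<close> with \<open>p = \<omega>\<^sub>M\<^sup>2 \<alpha>\<^sub>M\<^sup>-\<^sup>1(m)\<close>, after the copies of \<open>r\<close> have been
  moved along \<open>\<alpha>\<close>, \<open>\<beta>\<close> and \<open>\<omega>\<close> by invariance.
\<close>

section \<open>Evaluating tensors at multilinear maps\<close>

interpretation free: vector_space fscale
  by (rule vector_space_fscale)

lemma linear_ext_superset:
  assumes "finite S" "Poly_Mapping.keys p \<subseteq> S"
  shows "linear_ext h p = (\<Sum>x\<in>S. fscale (Poly_Mapping.lookup p x) (h x))"
  unfolding linear_ext_def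
  by (rule sum.mono_neutral_left) (use assms in \<open>auto simp: in_keys_iff\<close>)

lemma linear_ext_add: "linear_ext h (p + q) = linear_ext h p + linear_ext h q"
proof -
  let ?S = "Poly_Mapping.keys p \<union> Poly_Mapping.keys q"
  have "linear_ext h u = (\<Sum>x\<in>?S. fscale (Poly_Mapping.lookup u x) (h x))"
    if "Poly_Mapping.keys u \<subseteq> ?S" for u
    using that by (intro linear_ext_superset) auto
  then show ?thesis
    using Poly_Mapping.keys_add[of p q]
    by (simp add: lookup_add free.scale_left_distrib sum.distrib)
qed

lemma linear_ext_fscale: "linear_ext h (fscale c p) = fscale c (linear_ext h p)"
proof -
  have "linear_ext h (fscale c p)
      = (\<Sum>x\<in>Poly_Mapping.keys p. fscale (Poly_Mapping.lookup (fscale c p) x) (h x))"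
    by (rule linear_ext_superset) (auto simp: in_keys_iff)
  then show ?thesis
    by (simp add: linear_ext_def free.scale_sum_right)
qed

lemma linear_linear_ext: "Vector_Spaces.linear fscale fscale (linear_ext h)"
  by unfold_locales (simp_all add: linear_ext_add linear_ext_fscale)

interpretation linear_ext: Vector_Spaces.linear fscale fscale "linear_ext h"
  by (rule linear_linear_ext)

lemma linear_ext_gen [simp]: "linear_ext h (gen x) = h x"
  by (simp add: linear_ext_def)

lemma linear_ext_gen_id [simp]: "linear_ext gen p = p"
  by (rule poly_mapping_eqI)
     (auto simp: linear_ext_def lookup_sum lookup_single when_def if_distrib in_keys_iff
       cong: if_cong)

lemma linear_ext_linear_ext: "linear_ext f (linear_ext h p) = linear_ext (\<lambda>x. linear_ext f (h x)) p"
  unfolding linear_ext_def[of h] linear_ext_def[of "\<lambda>x. linear_ext f (h x)"]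
  by (simp add: linear_ext.sum linear_ext.scale)

definition annihilates ::
  "('x \<Rightarrow>\<^sub>0 'k::field) set \<Rightarrow> ('x \<Rightarrow> ('y \<Rightarrow>\<^sub>0 'k)) \<Rightarrow> bool" where
  "annihilates N h \<longleftrightarrow> (\<forall>p\<in>N. linear_ext h p = 0)"

definition ev :: "('x \<Rightarrow> ('y \<Rightarrow>\<^sub>0 'k::field)) \<Rightarrow> ('x \<Rightarrow>\<^sub>0 'k) set \<Rightarrow> ('y \<Rightarrow>\<^sub>0 'k)" where
  "ev h X = linear_ext h (rep X)"

lemma annihilates_span:
  "annihilates (free.span B) h \<longleftrightarrow> (\<forall>p\<in>B. linear_ext h p = 0)"
  unfolding annihilates_def
  using linear_ext.eq_0_on_span free.span_base by blast

lemma annihilates_tensor2: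
  "annihilates (tensor2 s t) h \<longleftrightarrow>
     (\<forall>a a' b. h (a + a', b) = h (a, b) + h (a', b)) \<and>
     (\<forall>c a b. h (s c a, b) = fscale c (h (a, b))) \<and>
     (\<forall>a b b'. h (a, b + b') = h (a, b) + h (a, b')) \<and>
     (\<forall>c a b. h (a, t c b) = fscale c (h (a, b)))"
  unfolding tensor2_def annihilates_span ball_Un
  by (simp add: Ball_def all_conj_distrib imp_ex)
     (auto simp: linear_ext.diff linear_ext.add linear_ext.scale diff_diff_eq)

lemma annihilates_tensor3:
  "annihilates (tensor3 s t u) h \<longleftrightarrow>
     (\<forall>a a' b d. h (a + a', b, d) = h (a, b, d) + h (a', b, d)) \<and>
     (\<forall>c a b d. h (s c a, b, d) = fscale c (h (a, b, d))) \<and>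
     (\<forall>a b b' d. h (a, b + b', d) = h (a, b, d) + h (a, b', d)) \<and>
     (\<forall>c a b d. h (a, t c b, d) = fscale c (h (a, b, d))) \<and>
     (\<forall>a b d d'. h (a, b, d + d') = h (a, b, d) + h (a, b, d')) \<and>
     (\<forall>c a b d. h (a, b, u c d) = fscale c (h (a, b, d)))"
  unfolding tensor3_def annihilates_span ball_Un
  by (simp add: Ball_def all_conj_distrib imp_ex)
     (auto simp: linear_ext.diff linear_ext.add linear_ext.scale diff_diff_eq)

lemma subspace_tensor2: "free.subspace (tensor2 s t)"
  by (simp add: tensor2_def)

lemma subspace_tensor3: "free.subspace (tensor3 s t u)"
  by (simp add: tensor3_def)

lemma rep_coset:
  assumes "free.subspace N"
  shows "rep (coset N p) - p \<in> N"
proof -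
  have "p \<in> coset N p"
    using assms by (simp add: coset_def free.subspace_0)
  then have "rep (coset N p) \<in> coset N p"
    unfolding rep_def by (rule someI)
  then show ?thesis by (simp add: coset_def)
qed

lemma coset_eq_iff:
  assumes "free.subspace N"
  shows "coset N p = coset N q \<longleftrightarrow> p - q \<in> N"
proof
  assume "coset N p = coset N q"
  moreover have "p \<in> coset N p"
    using assms by (simp add: coset_def free.subspace_0)
  ultimately show "p - q \<in> N" by (simp add: coset_def)
next
  assume pq: "p - q \<in> N"
  have "y - p \<in> N \<longleftrightarrow> y - q \<in> N" for y
    using free.subspace_add[OF assms _ pq, of "y - p"] free.subspace_diff[OF assms _ pq, of "y - q"]
    by (auto simp: algebra_simps)
  then show "coset N p = coset N q" by (auto simp: coset_def)
qed

lemma ev_coset: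
  assumes "free.subspace N" "annihilates N h"
  shows "ev h (coset N p) = linear_ext h p"
proof -
  have "linear_ext h (rep (coset N p) - p) = 0"
    using assms rep_coset unfolding annihilates_def by blast
  then show ?thesis by (simp add: ev_def linear_ext.diff)
qed

context
  fixes N :: "('x \<Rightarrow>\<^sub>0 'k::field) set" and h :: "'x \<Rightarrow> ('y \<Rightarrow>\<^sub>0 'k)"
  assumes N: "free.subspace N" and h: "annihilates N h"
begin

lemma ev_tadd: "ev h (X \<oplus>\<^bsub>N\<^esub> Y) = ev h X + ev h Y"
  unfolding tadd_def by (simp add: ev_coset[OF N h] linear_ext.add) (simp add: ev_def)

lemma ev_tdiff: "ev h (X \<ominus>\<^bsub>N\<^esub> Y) = ev h X - ev h Y"
  unfolding tdiff_def by (simp add: ev_coset[OF N h] linear_ext.diff) (simp add: ev_def)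

lemma ev_tscale: "ev h (c \<odot>\<^bsub>N\<^esub> X) = fscale c (ev h X)"
  unfolding tscale_def by (simp add: ev_coset[OF N h] linear_ext.scale) (simp add: ev_def)

lemma ev_pure: "ev h (pure N x) = h x"
  by (simp add: pure_def ev_coset[OF N h])

lemma ev_lift: "ev h (lift N (\<lambda>(a, b). g a b) X) = ev (\<lambda>(a, b). ev h (g a b)) X"
  by (simp add: lift_def ev_coset[OF N h] linear_ext_linear_ext) (simp add: ev_def case_prod_beta')

end

lemma ev_tmap:
  assumes "free.subspace N" "annihilates N h"
  shows "ev h (tmap N f g X) = ev (\<lambda>(a, b). h (f a, g b)) X"
  by (simp add: tmap_def ev_lift[OF assms] ev_pure[OF assms])

lemma ev_add_fun: "ev (\<lambda>(a, b). f a b + g a b) X = ev (\<lambda>(a, b). f a b) X + ev (\<lambda>(a, b). g a b) X"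
  by (simp add: ev_def linear_ext_def case_prod_beta' free.scale_right_distrib sum.distrib)

lemma ev_diff_fun: "ev (\<lambda>(a, b). f a b - g a b) X = ev (\<lambda>(a, b). f a b) X - ev (\<lambda>(a, b). g a b) X"
  by (simp add: ev_def linear_ext_def case_prod_beta' free.scale_right_diff_distrib sum_subtractf)

lemma ev_fscale_fun: "ev (\<lambda>(a, b). fscale c (f a b)) X = fscale c (ev (\<lambda>(a, b). f a b) X)"
  by (simp add: ev_def linear_ext_def case_prod_beta' free.scale_sum_right mult.commute)

lemma tensors_coset [simp]: "coset N p \<in> tensors N"
  by (simp add: tensors_def)

lemma tensors_closed [simp]:
  "X \<oplus>\<^bsub>N\<^esub> Y \<in> tensors N" "X \<ominus>\<^bsub>N\<^esub> Y \<in> tensors N" "c \<odot>\<^bsub>N\<^esub> X \<in> tensors N" "lift N f Z \<in> tensors N"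
  by (simp_all add: tadd_def tdiff_def tscale_def lift_def)

text \<open>The test maps come from a projection of the free space whose kernel is \<open>N\<close>.\<close>

lemma tensors_eqI:
  fixes N :: "('x \<Rightarrow>\<^sub>0 'k::field) set"
  assumes N: "free.subspace N" and XY: "X \<in> tensors N" "Y \<in> tensors N"
    and eq: "\<And>h :: 'x \<Rightarrow> ('x \<Rightarrow>\<^sub>0 'k). annihilates N h \<Longrightarrow> ev h X = ev h Y"
  shows "X = Y"
proof -
  obtain p q where pq: "X = coset N p" "Y = coset N q"
    using XY by (auto simp: tensors_def)
  interpret vector_space_pair fscale fscale
    by unfold_locales
  have "Vector_Spaces.linear fscale fscale (\<lambda>x :: 'x \<Rightarrow>\<^sub>0 'k. x)"
    by (rule free.linear_ident)
  from linear_exists_left_inverse_on[OF this N]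
  obtain g where g: "g ` UNIV \<subseteq> N" "Vector_Spaces.linear fscale fscale g" "\<And>v. v \<in> N \<Longrightarrow> g v = v"
    by auto
  define \<pi> where "\<pi> = (\<lambda>x. gen x - g (gen x))"
  interpret g: Vector_Spaces.linear fscale fscale g by (rule g(2))
  have \<pi>: "linear_ext \<pi> u = u - g u" for u
  proof -
    have "linear_ext \<pi> u = linear_ext gen u - g (linear_ext gen u)"
      unfolding linear_ext_def \<pi>_def
      by (simp add: free.scale_right_diff_distrib sum_subtractf g.sum g.scale)
    then show ?thesis by simp
  qed
  have ann: "annihilates N \<pi>"
    using g(3) by (simp add: annihilates_def \<pi>)
  have "linear_ext \<pi> (p - q) = 0"
    using eq[OF ann] by (simp add: pq ev_coset[OF N ann] linear_ext.diff)
  then have "p - q = g (p - q)" by (simp add: \<pi>)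
  then have "p - q \<in> N" using g(1) by auto
  then show ?thesis by (simp add: pq coset_eq_iff[OF N])
qed

lemma linear_simps:
  assumes "Vector_Spaces.linear s t f"
  shows "f (x + y) = f x + f y" "f (x - y) = f x - f y" "f (s c x) = t c (f x)" "f 0 = 0"
proof -
  interpret Vector_Spaces.linear s t f by fact
  show "f (x + y) = f x + f y" "f (x - y) = f x - f y" "f (s c x) = t c (f x)" "f 0 = 0"
    by (rule add diff scale zero)+
qed

lemma linear_inv:
  assumes f: "Vector_Spaces.linear s s f" and "bij f"
  shows "Vector_Spaces.linear s s (inv f)"
proof -
  interpret Vector_Spaces.linear s s f by fact
  have inv: "f (inv f x) = x" "inv f (f x) = x" for x
    using \<open>bij f\<close> by (simp_all add: bij_is_surj surj_f_inv_f bij_is_inj)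
  have "inv f (x + y) = inv f x + inv f y" for x y
    by (metis inv add)
  moreover have "inv f (s c x) = s c (inv f x)" for c x
    by (metis inv scale)
  ultimately show ?thesis by unfold_locales auto
qed

lemma linear_to_tensorsI:
  fixes N :: "('x \<Rightarrow>\<^sub>0 'k::field) set"
  assumes N: "free.subspace N" and "\<And>x. f x \<in> tensors N"
    and add: "\<And>h :: 'x \<Rightarrow> ('x \<Rightarrow>\<^sub>0 'k). \<And>x y. annihilates N h \<Longrightarrow> ev h (f (x + y)) = ev h (f x) + ev h (f y)"
    and scale: "\<And>h :: 'x \<Rightarrow> ('x \<Rightarrow>\<^sub>0 'k). \<And>c x. annihilates N h \<Longrightarrow> ev h (f (s c x)) = fscale c (ev h (f x))"
  shows "linear_to_tensors s N f"
  unfolding linear_to_tensors_def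
proof (intro conjI allI)
  show "f (x + y) = f x \<oplus>\<^bsub>N\<^esub> f y" for x y
    by (rule tensors_eqI[OF N]) (simp_all add: assms(2) ev_tadd[OF N] add)
  show "f (s c x) = c \<odot>\<^bsub>N\<^esub> f x" for c x
    by (rule tensors_eqI[OF N]) (simp_all add: assms(2) ev_tscale[OF N] scale)
qed (rule assms(2))

lemmas ev_simps = ev_tadd ev_tdiff ev_tscale ev_pure ev_lift ev_tmap subspace_tensor2 subspace_tensor3
lemmas ev_fun_simps = ev_add_fun ev_diff_fun ev_fscale_fun
lemmas free_simps = free.scale_right_distrib free.scale_right_diff_distrib free.scale_left_commute


section \<open>The comultiplication of a quasitriangular bialgebra\<close>

context quasitriangular_infBH_bialgebra
begin

lemmas A_linear_simps =
  linear_simps[OF linear_mult_left] linear_simps[OF linear_mult_right]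
  linear_simps[OF linear_\<alpha>] linear_simps[OF linear_\<beta>]
  linear_simps[OF linear_\<psi>] linear_simps[OF linear_\<omega>]
  linear_simps[OF linear_inv[OF linear_\<alpha> bij_\<alpha>]] linear_simps[OF linear_inv[OF linear_\<beta> bij_\<beta>]]

lemma inv_\<alpha> [simp]: "\<alpha> (inv \<alpha> a) = a" "inv \<alpha> (\<alpha> a) = a"
  using bij_\<alpha> by (simp_all add: bij_is_surj surj_f_inv_f bij_is_inj)

lemma inv_\<beta> [simp]: "\<beta> (inv \<beta> a) = a" "inv \<beta> (\<beta> a) = a"
  using bij_\<beta> by (simp_all add: bij_is_surj surj_f_inv_f bij_is_inj)

lemma inv_one [simp]: "inv \<alpha> one = one" "inv \<beta> one = one"
  by (metis \<alpha>_one inv_\<alpha>(2)) (metis \<beta>_one inv_\<beta>(2))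

lemma inv_\<alpha>_commute: "inv \<alpha> (\<beta> a) = \<beta> (inv \<alpha> a)" "\<omega> (inv \<alpha> a) = inv \<alpha> (\<omega> a)"
  by (metis \<alpha>_\<beta>_commute inv_\<alpha>) (metis \<omega>_\<alpha>_commute inv_\<alpha>)

lemma ev_r_invariant:
  assumes "annihilates (tensor2 scale scale) h" "f \<in> {\<alpha>, \<beta>, \<psi>, \<omega>}"
  shows "ev (\<lambda>(a, b). h (f a, f b)) r = ev h r"
  using assms(1) r_invariant[OF assms(2)] ev_tmap[OF subspace_tensor2, of scale scale h f f r] by simp

lemma ev_comult_r:
  assumes "annihilates (tensor2 scale scale) h"
  shows "ev h (comult_r lam scale mult one \<alpha> \<beta> \<psi> \<omega> r a) =
    ev (\<lambda>(x, y). h (mult (\<omega> (inv \<alpha> a)) x, \<beta> y)) r - ev (\<lambda>(x, y). h (\<alpha> x, mult y (\<psi> (inv \<beta> a)))) r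
    - fscale lam (h (\<omega> a, one))"
  using assms by (simp add: comult_r_def Let_def ev_simps)

lemma ev_yang_baxter:
  assumes "annihilates (tensor3 scale scale scale) h"
  shows "ev (\<lambda>(r1, r2). ev (\<lambda>(s1, s2). h (mult (\<omega> r1) s1, \<beta> s2, \<alpha> (\<psi> r2))) r) r
       - ev (\<lambda>(r1, r2). ev (\<lambda>(s1, s2). h (\<alpha> r1, mult r2 s1, \<beta> s2)) r) r
       + ev (\<lambda>(r1, r2). ev (\<lambda>(s1, s2). h (\<beta> (\<omega> r1), \<alpha> s1, mult s2 (\<psi> r2))) r) r
       = fscale lam (ev (\<lambda>(r1, r2). h (\<omega> r1, one, \<psi> r2)) r)"
  using arg_cong[OF r_yang_baxter[unfolded Let_def], of "ev h"] assms
  by (simp add: ev_simps)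

lemma linear_comult_r:
  "linear_to_tensors scale (tensor2 scale scale) (comult_r lam scale mult one \<alpha> \<beta> \<psi> \<omega> r)"
proof (rule linear_to_tensorsI[OF subspace_tensor2])
  show "comult_r lam scale mult one \<alpha> \<beta> \<psi> \<omega> r x \<in> tensors (tensor2 scale scale)" for x
    by (simp add: comult_r_def Let_def)
qed (simp_all add: ev_comult_r annihilates_tensor2 A_linear_simps ev_fun_simps free_simps)

text \<open>The two terms containing \<open>r\<close> cancel, by invariance of \<open>r\<close> under \<open>\<alpha>\<close> and \<open>\<beta>\<close>.\<close>

lemma ev_comult_r_one:
  assumes h: "annihilates (tensor2 scale scale) h"
  shows "ev h (comult_r lam scale mult one \<alpha> \<beta> \<psi> \<omega> r one) = - fscale lam (h (one, one))"
  using ev_r_invariant[OF h, of \<alpha>] ev_r_invariant[OF h, of \<beta>]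
  by (simp add: ev_comult_r[OF h] \<omega>_one \<psi>_one one_mult mult_one)

end


section \<open>The coaction on a module\<close>

locale quasitriangular_module =
  quasitriangular_infBH_bialgebra lam scaleA mult one \<alpha>A \<beta>A \<psi>A \<omega>A r +
  right_bihom_module scaleA mult \<alpha>A \<beta>A scaleM act \<alpha>M \<beta>M
  for lam :: "'k::field"
    and scaleA :: "'k \<Rightarrow> 'a::ab_group_add \<Rightarrow> 'a"
    and mult one \<alpha>A \<beta>A \<psi>A \<omega>A r
    and scaleM :: "'k \<Rightarrow> 'm::ab_group_add \<Rightarrow> 'm"
    and act \<alpha>M \<beta>M +
  fixes \<omega>M :: "'m \<Rightarrow> 'm"
  assumes bij_\<alpha>M: "bij \<alpha>M"
    and linear_\<omega>M: "Vector_Spaces.linear scaleM scaleM \<omega>M"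
    and \<alpha>M_\<omega>M: "\<And>m. \<alpha>M (\<omega>M m) = \<omega>M (\<alpha>M m)"
    and \<omega>M_act: "\<And>m a. \<omega>M (act m a) = act (\<omega>M m) (\<omega>A a)"
begin

abbreviation comult :: "'a \<Rightarrow> ('a \<times> 'a \<Rightarrow>\<^sub>0 'k) set" where
  "comult \<equiv> comult_r lam scaleA mult one \<alpha>A \<beta>A \<psi>A \<omega>A r"

definition coact :: "'m \<Rightarrow> ('m \<times> 'a \<Rightarrow>\<^sub>0 'k) set" where
  "coact m = (let T = tensor2 scaleM scaleA in
     lift T (\<lambda>(r1, r2). pure T (act (\<omega>M (inv \<alpha>M m)) r1, \<beta>A r2)) r
     \<ominus>\<^bsub>T\<^esub> lam \<odot>\<^bsub>T\<^esub> pure T (\<omega>M m, one))"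

lemmas AM_linear_simps = A_linear_simps
  linear_simps[OF linear_act_left] linear_simps[OF linear_act_right]
  linear_simps[OF linear_\<alpha>M] linear_simps[OF linear_\<omega>M]
  linear_simps[OF linear_inv[OF linear_\<alpha>M bij_\<alpha>M]]

lemma inv_\<alpha>M [simp]: "\<alpha>M (inv \<alpha>M m) = m" "inv \<alpha>M (\<alpha>M m) = m"
  using bij_\<alpha>M by (simp_all add: bij_is_surj surj_f_inv_f bij_is_inj)

lemma inv_\<alpha>M_commute: "\<omega>M (inv \<alpha>M m) = inv \<alpha>M (\<omega>M m)"
  by (metis \<alpha>M_\<omega>M inv_\<alpha>M)

lemma inv_\<alpha>M_act: "inv \<alpha>M (act m a) = act (inv \<alpha>M m) (inv \<alpha>A a)"
  by (metis \<alpha>M_act inv_\<alpha> inv_\<alpha>M)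

lemma act_act: "act (act m a) (\<beta>A a') = act (\<alpha>M m) (mult a a')"
  by (simp add: act_assoc)

lemma ev_coact:
  assumes "annihilates (tensor2 scaleM scaleA) h"
  shows "ev h (coact m) =
    ev (\<lambda>(x, y). h (act (\<omega>M (inv \<alpha>M m)) x, \<beta>A y)) r - fscale lam (h (\<omega>M m, one))"
  using assms by (simp add: coact_def Let_def ev_simps)

lemma linear_coact: "linear_to_tensors scaleM (tensor2 scaleM scaleA) coact"
proof (rule linear_to_tensorsI[OF subspace_tensor2])
  show "coact x \<in> tensors (tensor2 scaleM scaleA)" for x
    by (simp add: coact_def Let_def)
qed (simp_all add: ev_coact annihilates_tensor2 AM_linear_simps ev_fun_simps free_simps)

lemma tmap_coact:
  assumes f: "Vector_Spaces.linear scaleM scaleM f" "f' \<in> {\<psi>A, \<omega>A}"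
    and f_act: "\<And>m a. f (act m a) = act (f m) (f' a)"
    and comm: "\<And>m. \<alpha>M (f m) = f (\<alpha>M m)" "\<And>m. \<omega>M (f m) = f (\<omega>M m)"
  shows "tmap (tensor2 scaleM scaleA) f f' (coact m) = coact (f m)"
proof (rule tensors_eqI[OF subspace_tensor2])
  fix h :: "'m \<times> 'a \<Rightarrow> ('m \<times> 'a \<Rightarrow>\<^sub>0 'k)"
  assume h: "annihilates (tensor2 scaleM scaleA) h"
  have f': "f' (x + y) = f' x + f' y" "f' (scaleA c x) = scaleA c (f' x)"
    "f' one = one" "f' (\<beta>A x) = \<beta>A (f' x)" for c x y
    using f(2) by (auto simp: A_linear_simps \<psi>_one \<omega>_one \<psi>_\<beta>_commute \<omega>_\<beta>_commute)
  have inv: "inv \<alpha>M (f m) = f (inv \<alpha>M m)"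
    by (metis comm(1) inv_\<alpha>M)
  define n where "n = \<omega>M (inv \<alpha>M (f m))"
  have hn: "annihilates (tensor2 scaleA scaleA) (\<lambda>(x, y). h (act n x, \<beta>A y))"
    using h by (simp add: annihilates_tensor2 AM_linear_simps)
  have hf: "annihilates (tensor2 scaleM scaleA) (\<lambda>(x, y). h (f x, f' y))"
    using h by (simp add: annihilates_tensor2 linear_simps[OF f(1)] f')
  have "ev h (tmap (tensor2 scaleM scaleA) f f' (coact m)) = ev (\<lambda>(x, y). h (f x, f' y)) (coact m)"
    using h by (simp add: ev_simps)
  also have "\<dots> = ev (\<lambda>(x, y). h (act n (f' x), \<beta>A (f' y))) r - fscale lam (h (f (\<omega>M m), one))"
    by (simp add: ev_coact[OF hf] f_act f' comm(2)[symmetric] inv[symmetric] n_def)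
  also have "\<dots> = ev h (coact (f m))"
    using ev_r_invariant[OF hn, of f'] f(2)
    by (auto simp: ev_coact[OF h] comm(2) n_def)
  finally show "ev h (tmap (tensor2 scaleM scaleA) f f' (coact m)) = ev h (coact (f m))" .
qed (simp_all add: tmap_def coact_def Let_def)

lemma coact_act:
  "let T = tensor2 scaleM scaleA in
     coact (act m a) =
       lift T (\<lambda>(a1, a2). pure T (act (\<omega>M m) a1, \<beta>A a2)) (comult a)
       \<oplus>\<^bsub>T\<^esub> lift T (\<lambda>(m0, m1). pure T (\<alpha>M m0, mult m1 (\<psi>A a))) (coact m)
       \<oplus>\<^bsub>T\<^esub> lam \<odot>\<^bsub>T\<^esub> pure T (\<alpha>M (\<omega>M m), \<beta>A (\<psi>A a))"
  unfolding Let_def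
proof (rule tensors_eqI[OF subspace_tensor2])
  let ?T = "tensor2 scaleM scaleA"
  fix h :: "'m \<times> 'a \<Rightarrow> ('m \<times> 'a \<Rightarrow>\<^sub>0 'k)"
  assume h: "annihilates (tensor2 scaleM scaleA) h"
  define n where "n = \<omega>M (inv \<alpha>M (act m a))"
  have hn: "annihilates (tensor2 scaleA scaleA) (\<lambda>(x, y). h (act n x, \<beta>A y))"
    using h by (simp add: annihilates_tensor2 AM_linear_simps)
  have h1: "annihilates (tensor2 scaleA scaleA) (\<lambda>(x, y). h (act (\<omega>M m) x, \<beta>A y))"
    using h by (simp add: annihilates_tensor2 AM_linear_simps)
  have h2: "annihilates (tensor2 scaleM scaleA) (\<lambda>(x, y). h (\<alpha>M x, mult y (\<psi>A a)))"
    using h by (simp add: annihilates_tensor2 AM_linear_simps)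
  have n: "act (\<omega>M m) (mult (\<omega>A (inv \<alpha>A a)) x) = act n (\<beta>A x)" for x
    by (simp add: n_def inv_\<alpha>M_act \<omega>M_act act_act \<alpha>M_\<omega>M)
  have "ev (\<lambda>(x, y). h (act (\<omega>M m) (mult (\<omega>A (inv \<alpha>A a)) x), \<beta>A (\<beta>A y))) r
      = ev (\<lambda>(x, y). h (act n x, \<beta>A y)) r"
    using ev_r_invariant[OF hn, of \<beta>A] by (simp add: n)
  then show "ev h (coact (act m a)) =
    ev h (lift ?T (\<lambda>(a1, a2). pure ?T (act (\<omega>M m) a1, \<beta>A a2)) (comult a)
       \<oplus>\<^bsub>?T\<^esub> lift ?T (\<lambda>(m0, m1). pure ?T (\<alpha>M m0, mult m1 (\<psi>A a))) (coact m)
       \<oplus>\<^bsub>?T\<^esub> lam \<odot>\<^bsub>?T\<^esub> pure ?T (\<alpha>M (\<omega>M m), \<beta>A (\<psi>A a)))"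
    using h
    by (simp add: ev_simps ev_coact[OF h2] ev_comult_r[OF h1] ev_coact[OF h] n_def[symmetric]
        \<alpha>M_act \<alpha>M_\<omega>M \<beta>_mult \<beta>_one one_mult \<psi>_\<beta>_commute[symmetric] \<omega>M_act)
qed (simp_all add: coact_def Let_def)

lemma ev_yang_baxter_act:
  assumes h: "annihilates (tensor3 scaleM scaleA scaleA) h"
  shows "ev (\<lambda>(r1, r2). ev (\<lambda>(s1, s2). h (act p (\<omega>A r1), mult (\<omega>A (inv \<alpha>A (\<beta>A r2))) s1, \<beta>A s2)) r) r
       - ev (\<lambda>(r1, r2). ev (\<lambda>(s1, s2). h (act p (\<omega>A r1), \<alpha>A s1, mult s2 (\<psi>A r2))) r) r
       = ev (\<lambda>(r1, r2). ev (\<lambda>(s1, s2). h (act (inv \<alpha>M (act p (\<omega>A r1))) s1, \<beta>A s2, \<psi>A (\<beta>A r2))) r) r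
       - fscale lam (ev (\<lambda>(r1, r2). h (act p (\<omega>A r1), one, \<psi>A (\<beta>A r2))) r)"
    (is "?L1 - ?L2 = ?R1 - fscale lam ?R2")
proof -
  define k where "k = (\<lambda>(x, y, z). h (act p x, \<beta>A y, \<beta>A z))"
  have k: "annihilates (tensor3 scaleA scaleA scaleA) k"
    using h by (simp add: k_def annihilates_tensor3 AM_linear_simps)
  note h' = h[unfolded annihilates_tensor3]
  note inv = ev_r_invariant[where h = "case_prod f" for f, simplified]
  have "?R1 = ev (\<lambda>(r1, r2). ev (\<lambda>(s1, s2). h (act (inv \<alpha>M (act p (\<omega>A (\<alpha>A r1)))) s1, \<beta>A s2, \<psi>A (\<beta>A (\<alpha>A r2)))) r) r"
    by (rule inv[of _ \<alpha>A, symmetric])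
       (use h' in \<open>simp_all add: annihilates_tensor2 AM_linear_simps ev_fun_simps\<close>)
  also have "\<dots> = ev (\<lambda>(r1, r2). ev (\<lambda>(s1, s2). h (act (inv \<alpha>M (act p (\<omega>A (\<alpha>A r1)))) (\<beta>A s1), \<beta>A (\<beta>A s2), \<psi>A (\<beta>A (\<alpha>A r2)))) r) r"
    by (subst inv[of _ \<beta>A, symmetric])
       (use h' in \<open>simp_all add: annihilates_tensor2 AM_linear_simps ev_fun_simps\<close>)
  also have "\<dots> = ev (\<lambda>(r1, r2). ev (\<lambda>(s1, s2). k (mult (\<omega>A r1) s1, \<beta>A s2, \<alpha>A (\<psi>A r2))) r) r"
    by (simp add: k_def inv_\<alpha>M_act act_act inv_\<alpha>_commute \<omega>_\<alpha>_commute \<psi>_\<beta>_commute \<psi>_\<alpha>_commute \<alpha>_\<beta>_commute)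
  finally have R1: "?R1 = \<dots>" .
  have "?L1 = ev (\<lambda>(r1, r2). ev (\<lambda>(s1, s2). h (act p r1, mult (inv \<alpha>A (\<beta>A r2)) s1, \<beta>A s2)) r) r"
    unfolding inv_\<alpha>_commute
    by (subst inv[of _ \<omega>A, symmetric])
       (use h' in \<open>simp_all add: annihilates_tensor2 AM_linear_simps ev_fun_simps inv_\<alpha>_commute \<omega>_\<beta>_commute\<close>)
  also have "\<dots> = ev (\<lambda>(r1, r2). ev (\<lambda>(s1, s2). h (act p (\<alpha>A r1), mult (\<beta>A r2) s1, \<beta>A s2)) r) r"
    by (subst inv[of _ \<alpha>A, symmetric])
       (use h' in \<open>simp_all add: annihilates_tensor2 AM_linear_simps ev_fun_simps inv_\<alpha>_commute\<close>)
  also have "\<dots> = ev (\<lambda>(r1, r2). ev (\<lambda>(s1, s2). h (act p (\<alpha>A r1), mult (\<beta>A r2) (\<beta>A s1), \<beta>A (\<beta>A s2))) r) r"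
    by (subst inv[of _ \<beta>A, symmetric])
       (use h' in \<open>simp_all add: annihilates_tensor2 AM_linear_simps ev_fun_simps\<close>)
  also have "\<dots> = ev (\<lambda>(r1, r2). ev (\<lambda>(s1, s2). k (\<alpha>A r1, mult r2 s1, \<beta>A s2)) r) r"
    by (simp add: k_def \<beta>_mult)
  finally have L1: "?L1 = \<dots>" .
  have "?L2 = ev (\<lambda>(r1, r2). ev (\<lambda>(s1, s2). h (act p (\<omega>A (\<beta>A r1)), \<alpha>A s1, mult s2 (\<psi>A (\<beta>A r2)))) r) r"
    by (subst inv[of _ \<beta>A, symmetric])
       (use h' in \<open>simp_all add: annihilates_tensor2 AM_linear_simps ev_fun_simps\<close>)
  also have "\<dots> = ev (\<lambda>(r1, r2). ev (\<lambda>(s1, s2). h (act p (\<omega>A (\<beta>A r1)), \<alpha>A (\<beta>A s1), mult (\<beta>A s2) (\<psi>A (\<beta>A r2)))) r) r"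
    by (subst inv[of _ \<beta>A, symmetric])
       (use h' in \<open>simp_all add: annihilates_tensor2 AM_linear_simps ev_fun_simps\<close>)
  also have "\<dots> = ev (\<lambda>(r1, r2). ev (\<lambda>(s1, s2). k (\<beta>A (\<omega>A r1), \<alpha>A s1, mult s2 (\<psi>A r2))) r) r"
    by (simp add: k_def \<beta>_mult \<omega>_\<beta>_commute \<psi>_\<beta>_commute \<alpha>_\<beta>_commute)
  finally have L2: "?L2 = \<dots>" .
  have R2: "?R2 = ev (\<lambda>(r1, r2). k (\<omega>A r1, one, \<psi>A r2)) r"
    by (simp add: k_def \<beta>_one \<psi>_\<beta>_commute)
  show ?thesis
    using ev_yang_baxter[OF k] unfolding L1 L2 R1 R2 by (simp add: algebra_simps)
qed

lemma coact_coassoc: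
  "let T = tensor3 scaleM scaleA scaleA in
     lift T (\<lambda>(m0, m1). lift T (\<lambda>(a1, a2). pure T (\<omega>M m0, a1, a2)) (comult m1)) (coact m)
   = lift T (\<lambda>(m0, m1). lift T (\<lambda>(n0, n1). pure T (n0, n1, \<psi>A m1)) (coact m0)) (coact m)"
  unfolding Let_def
proof (rule tensors_eqI[OF subspace_tensor3])
  let ?T = "tensor3 scaleM scaleA scaleA"
  fix h :: "'m \<times> 'a \<times> 'a \<Rightarrow> ('m \<times> 'a \<times> 'a \<Rightarrow>\<^sub>0 'k)"
  assume h: "annihilates ?T h"
  note h' = h[unfolded annihilates_tensor3]
  define n where "n = \<omega>M (inv \<alpha>M m)"
  have h1: "annihilates (tensor2 scaleA scaleA) (\<lambda>(a1, a2). h (m0, a1, a2))" for m0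
    using h' by (simp add: annihilates_tensor2)
  have h2: "annihilates (tensor2 scaleM scaleA) (\<lambda>(n0, n1). h (n0, n1, \<psi>A m1))" for m1
    using h' by (simp add: annihilates_tensor2)
  have H1: "annihilates (tensor2 scaleM scaleA)
      (\<lambda>(m0, m1). ev (\<lambda>(a1, a2). h (\<omega>M m0, a1, a2)) (comult m1))"
    using h' by (simp add: annihilates_tensor2 ev_comult_r h1 AM_linear_simps ev_fun_simps free_simps)
  have H2: "annihilates (tensor2 scaleM scaleA)
      (\<lambda>(m0, m1). ev (\<lambda>(n0, n1). h (n0, n1, \<psi>A m1)) (coact m0))"
    using h' by (simp add: annihilates_tensor2 ev_coact h2 AM_linear_simps ev_fun_simps free_simps)
  have inv\<omega>: "ev (\<lambda>(x, y). h (act (\<omega>M n) (\<omega>A x), \<omega>A (\<beta>A y), one)) r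
      = ev (\<lambda>(x, y). h (act (\<omega>M n) x, \<beta>A y, one)) r"
    using ev_r_invariant[of "\<lambda>(x, y). h (act (\<omega>M n) x, \<beta>A y, one)" \<omega>A] h'
    by (simp add: annihilates_tensor2 AM_linear_simps \<omega>_\<beta>_commute)
  have "ev h (lift ?T (\<lambda>(m0, m1). lift ?T (\<lambda>(a1, a2). pure ?T (\<omega>M m0, a1, a2)) (comult m1)) (coact m))
      = ev (\<lambda>(m0, m1). ev (\<lambda>(a1, a2). h (\<omega>M m0, a1, a2)) (comult m1)) (coact m)"
    using h by (simp add: ev_simps)
  also have "\<dots> = ev (\<lambda>(r1, r2). ev (\<lambda>(s1, s2). h (act (\<omega>M n) (\<omega>A r1), mult (\<omega>A (inv \<alpha>A (\<beta>A r2))) s1, \<beta>A s2)) r) r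
       - ev (\<lambda>(r1, r2). ev (\<lambda>(s1, s2). h (act (\<omega>M n) (\<omega>A r1), \<alpha>A s1, mult s2 (\<psi>A r2))) r) r
       - fscale lam (ev (\<lambda>(x, y). h (act (\<omega>M n) x, \<beta>A y, one)) r)
       + fscale lam (fscale lam (h (\<omega>M (\<omega>M m), one, one)))"
    unfolding ev_coact[OF H1] prod.case ev_comult_r_one[OF h1]
    by (simp add: ev_comult_r[OF h1] ev_fun_simps inv\<omega> \<omega>M_act
        n_def[symmetric])
  also have "\<dots> = ev (\<lambda>(r1, r2). ev (\<lambda>(s1, s2). h (act (inv \<alpha>M (act (\<omega>M n) (\<omega>A r1))) s1, \<beta>A s2, \<psi>A (\<beta>A r2))) r) r
       - fscale lam (ev (\<lambda>(r1, r2). h (act (\<omega>M n) (\<omega>A r1), one, \<psi>A (\<beta>A r2))) r)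
       - fscale lam (ev (\<lambda>(x, y). h (act (\<omega>M n) x, \<beta>A y, one)) r)
       + fscale lam (fscale lam (h (\<omega>M (\<omega>M m), one, one)))"
    by (simp only: ev_yang_baxter_act[OF h])
  also have "\<dots> = ev (\<lambda>(m0, m1). ev (\<lambda>(n0, n1). h (n0, n1, \<psi>A m1)) (coact m0)) (coact m)"
    unfolding ev_coact[OF H2] prod.case unfolding ev_coact[OF h2]
    by (simp add: ev_fun_simps free_simps \<psi>_one n_def inv_\<alpha>M_commute \<omega>M_act
        inv_\<alpha>M_act inv_\<alpha>_commute)
  also have "\<dots> = ev h (lift ?T (\<lambda>(m0, m1). lift ?T (\<lambda>(n0, n1). pure ?T (n0, n1, \<psi>A m1)) (coact m0)) (coact m))"
    using h by (simp add: ev_simps)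
  finally show "ev h (lift ?T (\<lambda>(m0, m1). lift ?T (\<lambda>(a1, a2). pure ?T (\<omega>M m0, a1, a2)) (comult m1)) (coact m))
    = ev h (lift ?T (\<lambda>(m0, m1). lift ?T (\<lambda>(n0, n1). pure ?T (n0, n1, \<psi>A m1)) (coact m0)) (coact m))" .
qed simp_all

end

theorem theorem2p44:
  fixes lam :: "'k::field"
    and scaleA :: "'k \<Rightarrow> 'a::ab_group_add \<Rightarrow> 'a"
    and mult :: "'a \<Rightarrow> 'a \<Rightarrow> 'a" and one :: 'a
    and \<alpha>A \<beta>A \<psi>A \<omega>A :: "'a \<Rightarrow> 'a"
    and r :: "('a \<times> 'a \<Rightarrow>\<^sub>0 'k) set"
    and scaleM :: "'k \<Rightarrow> 'm::ab_group_add \<Rightarrow> 'm"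
    and act :: "'m \<Rightarrow> 'a \<Rightarrow> 'm"
    and \<alpha>M \<beta>M \<psi>M \<omega>M :: "'m \<Rightarrow> 'm"
    and \<phi> :: "'m \<Rightarrow> ('m \<times> 'a \<Rightarrow>\<^sub>0 'k) set"
  assumes A: "quasitriangular_infBH_bialgebra lam scaleA mult one \<alpha>A \<beta>A \<psi>A \<omega>A r"
    and M: "right_bihom_module scaleA mult \<alpha>A \<beta>A scaleM act \<alpha>M \<beta>M"
    and bij_\<alpha>M: "bij \<alpha>M"
    and linear_\<psi>M: "Vector_Spaces.linear scaleM scaleM \<psi>M"
    and linear_\<omega>M: "Vector_Spaces.linear scaleM scaleM \<omega>M"
    and \<alpha>M_\<omega>M: "\<And>m. \<alpha>M (\<omega>M m) = \<omega>M (\<alpha>M m)"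
    and \<omega>M_act: "\<And>m a. \<omega>M (act m a) = act (\<omega>M m) (\<omega>A a)"
    and \<alpha>M_\<psi>M: "\<And>m. \<alpha>M (\<psi>M m) = \<psi>M (\<alpha>M m)"
    and \<beta>M_\<psi>M: "\<And>m. \<beta>M (\<psi>M m) = \<psi>M (\<beta>M m)"
    and \<beta>M_\<omega>M: "\<And>m. \<beta>M (\<omega>M m) = \<omega>M (\<beta>M m)"
    and \<psi>M_\<omega>M: "\<And>m. \<psi>M (\<omega>M m) = \<omega>M (\<psi>M m)"
    and \<psi>M_act: "\<And>m a. \<psi>M (act m a) = act (\<psi>M m) (\<psi>A a)"
    and \<phi>: "\<And>m. \<phi> m =
      (let T = tensor2 scaleM scaleA in
         lift T (\<lambda>(r1, r2). pure T (act (\<omega>M (inv \<alpha>M m)) r1, \<beta>A r2)) r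
         \<ominus>\<^bsub>T\<^esub> lam \<odot>\<^bsub>T\<^esub> pure T (\<omega>M m, one))"
  shows "right_infBH_hopf_module lam scaleA mult \<alpha>A \<beta>A
    (comult_r lam scaleA mult one \<alpha>A \<beta>A \<psi>A \<omega>A r) \<psi>A \<omega>A
    scaleM act \<phi> \<alpha>M \<beta>M \<psi>M \<omega>M"
proof -
  interpret quasitriangular_module lam scaleA mult one \<alpha>A \<beta>A \<psi>A \<omega>A r scaleM act \<alpha>M \<beta>M \<omega>M
    using A M bij_\<alpha>M linear_\<omega>M \<alpha>M_\<omega>M \<omega>M_act
    by (intro quasitriangular_module.intro quasitriangular_module_axioms.intro) auto
  have \<phi>_coact: "\<phi> = coact"
    by (rule ext) (simp add: \<phi> coact_def)
  show ?thesis
    unfolding \<phi>_coact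
  proof (intro right_infBH_hopf_module.intro right_bihom_comodule.intro
      right_bihom_comodule_axioms.intro right_infBH_hopf_module_axioms.intro)
    show "tmap (tensor2 scaleM scaleA) \<psi>M \<psi>A (coact m) = coact (\<psi>M m)" for m
      by (rule tmap_coact) (simp_all add: linear_\<psi>M \<psi>M_act \<alpha>M_\<psi>M \<psi>M_\<omega>M)
    show "tmap (tensor2 scaleM scaleA) \<omega>M \<omega>A (coact m) = coact (\<omega>M m)" for m
      by (rule tmap_coact) (simp_all add: linear_\<omega>M \<omega>M_act \<alpha>M_\<omega>M)
  qed (fact M linear_comult_r linear_coact coact_coassoc coact_act linear_\<psi> linear_\<omega>
      linear_\<psi>M linear_\<omega>M \<psi>M_\<omega>M \<alpha>M_\<psi>M \<alpha>M_\<omega>M \<beta>M_\<psi>M \<beta>M_\<omega>M vector_space_axioms M.vector_space_axioms)+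
qed

end
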